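(* Let $\omega$ be a weight and, for each $n\in\mathbb{N}$, let $m(\omega,n)$ be a median function of $\omega$ relative to $\mathcal{F}_n$. Then the implications $(1)\Rightarrow(2)\Rightarrow(3)\Rightarrow(4)$ hold for the following statements. (1) ($\omega\in\bigcup_{p>1}A_p$) There exist $C,p>1$ such that for all $n\in\mathbb{N}$, $\mathbb{E}(\omega|\mathcal{F}_n)\,\mathbb{E}(\omega^{-\frac{1}{p-1}}|\mathcal{F}_n)^{p-1}\le C$. (2) ($\omega\in A_\infty^{exp}$) There exists a positive constant $C$ such that for all $n\in\mathbb{N}$, $\mathbb{E}(\omega|\mathcal{F}_n)\le C\exp\mathbb{E}(\log\omega|\mathcal{F}_n)$. (3) ($\omega\in A_\infty^{med}$) There exists $C>1$ such that for all $n\in\mathbb{N}$, $\omega_n\le C\,m(\omega,n)$. (4) ($\omega\in A_\infty^{M}$) There exist $0<\alpha,\beta<1$ such that for all $n\in\mathbb{N}$ and $A\in\mathcal{F}$: $\mathbb{E}(\chi_A|\mathcal{F}_n)\le\alpha<1\Rightarrow\mathbb{E}_\omega(\chi_A|\mathcal{F}_n)\le\beta<1$.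
   Context: $(\Omega,\mathcal{F},\mu)$ is a complete probability space and $(\mathcal{F}_n)_{n\ge0}$ is an increasing sequence of sub-$\sigma$-fields of $\mathcal{F}$ with $\mathcal{F}=\bigvee_{n\ge0}\mathcal{F}_n$. $\mathbb{N}$ is the set of non-negative integers. $\mathbb{E}(\cdot|\mathcal{F}_n)$ is conditional expectation with respect to $\mu$ (of nonnegative functions it may take the value $+\infty$). Relations between random variables hold almost surely. A weight $\omega$ is a random variable with $\omega>0$ and $\mathbb{E}(\omega)<\infty$; $\omega_n:=\mathbb{E}(\omega|\mathcal{F}_n)$. $\mathbb{E}_\omega(\cdot|\mathcal{F}_n)$ is the conditional expectation with respect to $\omega\,d\mu$, i.e. $\mathbb{E}_\omega(f|\mathcal{F}_n)=\mathbb{E}(f\omega|\mathcal{F}_n)/\omega_n$. $\chi_A$ is the indicator function of $A$. The conditional expectation $\mathbb{E}(\log\omega|\mathcal{F}_n)$ takes values in $[-\infty,\infty)$, with $\exp(-\infty)=0$. A median function of $\omega$ relative to $\mathcal{F}_n$ is an $\mathcal{F}_n$-measurable function $m(\omega,n)$ such that $\mathbb{E}(\chi_{\{\omega>m(\omega,n)\}}|\mathcal{F}_n)\le 1/2$ and $\mathbb{E}(\chi_{\{\omega<m(\omega,n)\}}|\mathcal{F}_n)\le 1/2$. *)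

theory Defs
  imports "HOL-Probability.Probability"
begin

text \<open>
  Conditional expectations of integrable functions are \<^const>\<open>real_cond_exp\<close>; those of nonnegative
  functions that need not be integrable are \<^const>\<open>nn_cond_exp\<close>, with values in \<^typ>\<open>ennreal\<close>.
  Relations between random variables are required almost everywhere.
\<close>

definition weight :: "'a measure \<Rightarrow> ('a \<Rightarrow> real) \<Rightarrow> bool" where
  "weight M \<omega> \<longleftrightarrow> integrable M \<omega> \<and> (AE x in M. \<omega> x > 0)"

text \<open>Only used for exponents \<open>a > 0\<close>, where \<open>\<infinity>\<^sup>a = \<infinity>\<close>.\<close>

definition ennpowr :: "ennreal \<Rightarrow> real \<Rightarrow> ennreal" where
  "ennpowr y a = (if y = \<infinity> then \<infinity> else ennreal (enn2real y powr a))"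

definition ereal_exp :: "ereal \<Rightarrow> ennreal" where
  "ereal_exp y = (case y of ereal r \<Rightarrow> ennreal (exp r) | PInfty \<Rightarrow> \<infinity> | MInfty \<Rightarrow> 0)"

text \<open>
  Conditional expectation of a function whose negative part need not be integrable, as
  \<open>E(f\<^sup>+|F) - E(f\<^sup>-|F)\<close> (\<^const>\<open>ennreal\<close> truncates negative reals to 0).  It is meaningful whenever
  \<open>E(f\<^sup>+|F) < \<infinity>\<close> a.e., which holds for \<open>f = ln \<omega>\<close> with \<open>\<omega>\<close> a weight since \<open>(ln \<omega>)\<^sup>+ \<le> \<omega>\<close>.
  By contrast, \<^const>\<open>real_cond_exp\<close> replaces an infinite \<open>E(f\<^sup>-|F)\<close> by 0.
\<close>

definition ereal_cond_exp :: "'a measure \<Rightarrow> 'a measure \<Rightarrow> ('a \<Rightarrow> real) \<Rightarrow> 'a \<Rightarrow> ereal" where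
  "ereal_cond_exp M F f x =
     enn2ereal (nn_cond_exp M F (\<lambda>y. ennreal (f y)) x)
     - enn2ereal (nn_cond_exp M F (\<lambda>y. ennreal (- f y)) x)"

definition weighted_cond_exp ::
  "'a measure \<Rightarrow> 'a measure \<Rightarrow> ('a \<Rightarrow> real) \<Rightarrow> ('a \<Rightarrow> real) \<Rightarrow> 'a \<Rightarrow> real" where
  "weighted_cond_exp M F \<omega> f x =
     real_cond_exp M F (\<lambda>y. f y * \<omega> y) x / real_cond_exp M F \<omega> x"

definition median_function :: "'a measure \<Rightarrow> 'a measure \<Rightarrow> ('a \<Rightarrow> real) \<Rightarrow> ('a \<Rightarrow> real) \<Rightarrow> bool" where
  "median_function M F \<omega> m \<longleftrightarrow>
     m \<in> borel_measurable F \<and>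
     (AE x in M. real_cond_exp M F (indicat_real {y \<in> space M. \<omega> y > m y}) x \<le> 1 / 2) \<and>
     (AE x in M. real_cond_exp M F (indicat_real {y \<in> space M. \<omega> y < m y}) x \<le> 1 / 2)"

definition A_p :: "'a measure \<Rightarrow> (nat \<Rightarrow> 'a measure) \<Rightarrow> real \<Rightarrow> ('a \<Rightarrow> real) \<Rightarrow> bool" where
  "A_p M F p \<omega> \<longleftrightarrow>
     (\<exists>C>1. \<forall>n. AE x in M.
        ennreal (real_cond_exp M (F n) \<omega> x) *
        ennpowr (nn_cond_exp M (F n) (\<lambda>y. ennreal (\<omega> y powr (- (1 / (p - 1))))) x) (p - 1)
        \<le> ennreal C)"

definition A_inf_exp :: "'a measure \<Rightarrow> (nat \<Rightarrow> 'a measure) \<Rightarrow> ('a \<Rightarrow> real) \<Rightarrow> bool" where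
  "A_inf_exp M F \<omega> \<longleftrightarrow>
     (\<exists>C>0. \<forall>n. AE x in M.
        ennreal (real_cond_exp M (F n) \<omega> x)
        \<le> ennreal C * ereal_exp (ereal_cond_exp M (F n) (\<lambda>y. ln (\<omega> y)) x))"

definition A_inf_med :: "'a measure \<Rightarrow> (nat \<Rightarrow> 'a measure) \<Rightarrow> (nat \<Rightarrow> 'a \<Rightarrow> real) \<Rightarrow> ('a \<Rightarrow> real) \<Rightarrow> bool" where
  "A_inf_med M F m \<omega> \<longleftrightarrow>
     (\<exists>C>1. \<forall>n. AE x in M. real_cond_exp M (F n) \<omega> x \<le> C * m n x)"

text \<open>
  The implication is between two a.e. inequalities on the whole space.  Its version on the event
  where the premise holds is equivalent: apply it to the intersection of \<open>A\<close> with the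
  \<open>F n\<close>-measurable set on which \<open>E(\<chi>\<^sub>A|F n) \<le> \<alpha>\<close>.
\<close>

definition A_inf_M :: "'a measure \<Rightarrow> (nat \<Rightarrow> 'a measure) \<Rightarrow> ('a \<Rightarrow> real) \<Rightarrow> bool" where
  "A_inf_M M F \<omega> \<longleftrightarrow>
     (\<exists>\<alpha> \<beta>. 0 < \<alpha> \<and> \<alpha> < 1 \<and> 0 < \<beta> \<and> \<beta> < 1 \<and>
        (\<forall>n. \<forall>A\<in>sets M.
           (AE x in M. real_cond_exp M (F n) (indicat_real A) x \<le> \<alpha>) \<longrightarrow>
           (AE x in M. weighted_cond_exp M (F n) \<omega> (indicat_real A) x \<le> \<beta>)))"

end

theory Submission
  imports Defs
begin

text \<open>
  Each implication holds for one \<open>\<sigma>\<close>-field \<open>F\<close> at a time, with constants that depend only on the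
  given constant, never on \<open>F\<close>.  Write
  \<open>W = E(\<omega>|F)\<close>, which is positive almost everywhere.

  The logarithm is controlled by conditional Jensen inequalities.  As \<open>ln \<omega>\<close> may fail to be
  integrable, they are derived from the tangent inequality \<open>ln t \<le> t - 1\<close>, applied
  to \<open>t\<close> divided by a positive \<open>F\<close>-measurable function of our choice.  This gives a pointwise bound
  of the form \<open>f \<le> b + h\<close> with \<open>b\<close> measurable for \<open>F\<close> and \<open>h \<ge> 0\<close>, and
  \<open>ereal_cond_exp_le\<close> says that such a bound survives taking conditional expectations, infinite
  values included.

  From \<open>A\<^sub>p\<close> to the exponential condition (\<open>exp_bound_if_A_p_bound\<close>): with \<open>s = 1/(p-1)\<close> the
  \<open>A\<^sub>p\<close> bound reads \<open>E(\<omega>\<^sup>-\<^sup>s|F) \<le> c\<close> where \<open>c = (C/W)\<^sup>s\<close>.  The tangent inequality at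
  \<open>\<omega>\<^sup>-\<^sup>s/c\<close> yields \<open>-s E(ln \<omega>|F) \<le> ln c\<close>, that is \<open>W \<le> C exp E(ln \<omega>|F)\<close>.

  From the exponential to the median condition (\<open>median_bound_if_exp_bound\<close>): only the set
  \<open>{\<omega> > m}\<close>, of conditional probability at most \<open>1/2\<close>, contributes positively to
  \<open>E(ln (\<omega>/m)|F)\<close>.  Jensen on this set gives \<open>E(ln (\<omega>/m)|F) \<le> (ln a)/2\<close> with
  \<open>a = max (2 R) e\<close> and \<open>R = W/m\<close>.  The exponential condition therefore yields \<open>R \<le> C sqrt a\<close>, and since the
  right side grows only like the square root of \<open>R\<close>, the ratio is bounded.

  From the median to Muckenhoupt's condition (\<open>weighted_cond_exp_le_if_median_bound\<close>): if
  \<open>E(\<chi>\<^sub>A|F) \<le> 1/4\<close>, then the part of \<open>{\<omega> \<ge> m}\<close> outside \<open>A\<close> has conditional probability at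
  least \<open>1/2 - 1/4\<close>, and \<open>\<omega> \<ge> m \<ge> W/C\<close> there.  So the complement of \<open>A\<close> carries at least the
  fraction \<open>1/(4C)\<close> of the weighted mass.
\<close>

section \<open>Conditional expectations with infinite values\<close>

lemma (in sigma_finite_subalgebra) nn_cond_exp_integrable:
  assumes f: "integrable M f" and nonneg: "AE x in M. 0 \<le> f x"
  shows "AE x in M. nn_cond_exp M F (\<lambda>y. ennreal (f y)) x = ennreal (real_cond_exp M F f x)"
proof -
  have [measurable]: "f \<in> borel_measurable M" using f by simp
  have "(\<integral>\<^sup>+x. nn_cond_exp M F (\<lambda>y. ennreal (f y)) x \<partial>M) = (\<integral>\<^sup>+x. ennreal (f x) \<partial>M)"
    using nn_cond_exp_intg[of "\<lambda>_. 1" "\<lambda>y. ennreal (f y)"] by simp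
  also have "\<dots> \<noteq> \<infinity>"
    using integrableD(2)[OF f] nonneg by (simp add: nn_integral_eq_integral[OF f nonneg])
  finally have fin: "AE x in M. nn_cond_exp M F (\<lambda>y. ennreal (f y)) x \<noteq> \<infinity>"
    by (intro nn_integral_PInf_AE) auto
  have "AE x in M. nn_cond_exp M F (\<lambda>y. ennreal (- f y)) x = nn_cond_exp M F (\<lambda>_. 0) x"
    using nonneg by (intro nn_cond_exp_cong) (auto simp: ennreal_neg)
  moreover have "AE x in M. 0 = nn_cond_exp M F (\<lambda>_. 0) x"
    by (intro nn_cond_exp_F_meas) auto
  ultimately show ?thesis
    using fin
  proof eventually_elim
    case (elim x)
    then show ?case by (simp add: real_cond_exp_def less_top)
  qed
qed

lemma (in sigma_finite_subalgebra) nn_cond_exp_mult_left: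
  assumes k [measurable]: "k \<in> borel_measurable F" and nonneg: "AE x in M. 0 \<le> k x"
    and [measurable]: "g \<in> borel_measurable M"
  shows "AE x in M. nn_cond_exp M F (\<lambda>y. ennreal (k y * g y)) x
                   = ennreal (k x) * nn_cond_exp M F (\<lambda>y. ennreal (g y)) x"
proof -
  have [measurable]: "k \<in> borel_measurable M"
    using measurable_from_subalg[OF subalg k] .
  have "AE x in M. nn_cond_exp M F (\<lambda>y. ennreal (k y * g y)) x
                 = nn_cond_exp M F (\<lambda>y. ennreal (k y) * ennreal (g y)) x"
    using nonneg by (intro nn_cond_exp_cong) (auto simp: ennreal_mult')
  moreover have "AE x in M. ennreal (k x) * nn_cond_exp M F (\<lambda>y. ennreal (g y)) x
                 = nn_cond_exp M F (\<lambda>y. ennreal (k y) * ennreal (g y)) x"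
    by (intro nn_cond_exp_prod) auto
  ultimately show ?thesis by eventually_elim simp
qed

text \<open>
  Moving all negative parts to the other side turns \<open>f \<le> b + h\<close> into
  \<open>f\<^sup>+ + b\<^sup>- \<le> f\<^sup>- + b\<^sup>+ + h\<close>, an inequality between nonnegative functions, to which the additivity
  and monotonicity of \<^const>\<open>nn_cond_exp\<close> apply without any integrability.  The differences can be
  formed again because also \<open>f\<^sup>+ \<le> b\<^sup>+ + h\<close>: either \<open>E(h|F) = \<infinity>\<close> and there is nothing to
  prove, or \<open>E(f\<^sup>+|F) < \<infinity>\<close>, which excludes the ambiguous value \<open>\<infinity> - \<infinity>\<close>.
\<close>

lemma (in sigma_finite_subalgebra) ereal_cond_exp_le:
  assumes f [measurable]: "f \<in> borel_measurable M"
    and b [measurable]: "b \<in> borel_measurable F"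
    and h [measurable]: "h \<in> borel_measurable M"
    and nonneg: "AE x in M. 0 \<le> h x"
    and le: "AE x in M. f x \<le> b x + h x"
  shows "AE x in M. ereal_cond_exp M F f x
                   \<le> ereal (b x) + enn2ereal (nn_cond_exp M F (\<lambda>y. ennreal (h y)) x)"
proof -
  let ?E = "nn_cond_exp M F"
  have [measurable]: "b \<in> borel_measurable M"
    using measurable_from_subalg[OF subalg b] .
  have "AE x in M. ?E (\<lambda>y. ennreal (f y) + ennreal (- b y)) x
                 \<le> ?E (\<lambda>y. (ennreal (- f y) + ennreal (b y)) + ennreal (h y)) x"
  proof (rule nn_cond_exp_mono)
    show "AE x in M. ennreal (f x) + ennreal (- b x)
                   \<le> (ennreal (- f x) + ennreal (b x)) + ennreal (h x)"
      using nonneg le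
    proof eventually_elim
      case (elim x)
      then have "max 0 (f x) + max 0 (- b x) \<le> max 0 (- f x) + max 0 (b x) + max 0 (h x)"
        by linarith
      then have "ennreal (max 0 (f x) + max 0 (- b x))
               \<le> ennreal (max 0 (- f x) + max 0 (b x) + max 0 (h x))"
        by (rule ennreal_leI)
      then show ?case by simp
    qed
  qed measurable
  moreover have "AE x in M. ?E (\<lambda>y. ennreal (f y)) x \<le> ?E (\<lambda>y. ennreal (b y) + ennreal (h y)) x"
  proof (rule nn_cond_exp_mono)
    show "AE x in M. ennreal (f x) \<le> ennreal (b x) + ennreal (h x)"
      using nonneg le
    proof eventually_elim
      case (elim x)
      then have "max 0 (f x) \<le> max 0 (b x) + max 0 (h x)"
        by linarith
      then have "ennreal (max 0 (f x)) \<le> ennreal (max 0 (b x) + max 0 (h x))"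
        by (rule ennreal_leI)
      then show ?case by simp
    qed
  qed measurable
  moreover have "AE x in M. ?E (\<lambda>y. ennreal (f y)) x + ?E (\<lambda>y. ennreal (- b y)) x
                 = ?E (\<lambda>y. ennreal (f y) + ennreal (- b y)) x"
    by (intro nn_cond_exp_sum) auto
  moreover have "AE x in M. ?E (\<lambda>y. ennreal (- f y) + ennreal (b y)) x + ?E (\<lambda>y. ennreal (h y)) x
                 = ?E (\<lambda>y. (ennreal (- f y) + ennreal (b y)) + ennreal (h y)) x"
    by (intro nn_cond_exp_sum) auto
  moreover have "AE x in M. ?E (\<lambda>y. ennreal (- f y)) x + ?E (\<lambda>y. ennreal (b y)) x
                 = ?E (\<lambda>y. ennreal (- f y) + ennreal (b y)) x"
    by (intro nn_cond_exp_sum) auto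
  moreover have "AE x in M. ?E (\<lambda>y. ennreal (b y)) x + ?E (\<lambda>y. ennreal (h y)) x
                 = ?E (\<lambda>y. ennreal (b y) + ennreal (h y)) x"
    by (intro nn_cond_exp_sum) auto
  moreover have "AE x in M. ennreal (b x) = ?E (\<lambda>y. ennreal (b y)) x"
    by (intro nn_cond_exp_F_meas) auto
  moreover have "AE x in M. ennreal (- b x) = ?E (\<lambda>y. ennreal (- b y)) x"
    by (intro nn_cond_exp_F_meas) auto
  ultimately show ?thesis
  proof eventually_elim
    case (elim x)
    let ?P = "?E (\<lambda>y. ennreal (f y)) x" and ?N = "?E (\<lambda>y. ennreal (- f y)) x"
      and ?H = "?E (\<lambda>y. ennreal (h y)) x"
    have two: "?P + ennreal (- b x) \<le> ?N + ennreal (b x) + ?H" "?P \<le> ennreal (b x) + ?H"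
      using elim by simp_all
    show ?case
    proof (cases "?H = \<infinity>")
      case True
      then show ?thesis by simp
    next
      case H: False
      with two(2) have P: "?P \<noteq> \<infinity>"
        by (auto simp: top_unique)
      show ?thesis
      proof (cases "?N = \<infinity>")
        case True
        with P show ?thesis
          by (cases ?P) (simp_all add: ereal_cond_exp_def)
      next
        case False
        with H P obtain p n q where pnq: "?P = ennreal p" "?N = ennreal n" "?H = ennreal q"
          "0 \<le> p" "0 \<le> n" "0 \<le> q"
          by (metis ennreal_cases infinity_ennreal_def)
        have "ennreal (p + max 0 (- b x)) \<le> ennreal (n + max 0 (b x) + q)"
          using two(1) pnq by simp
        then have "p + max 0 (- b x) \<le> n + max 0 (b x) + q"
          using pnq by (subst (asm) ennreal_le_iff) auto
        then show ?thesis
          using pnq by (simp add: ereal_cond_exp_def)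
      qed
    qed
  qed
qed

lemma ereal_exp_mono:
  assumes "a \<le> b"
  shows "ereal_exp a \<le> ereal_exp b"
  using assms by (cases a; cases b) (auto simp: ereal_exp_def intro: ennreal_leI)

section \<open>From \<open>A\<^sub>p\<close> to the exponential condition\<close>

text \<open>
  The tangent point is the upper bound \<open>c\<close> for \<open>E(\<omega>\<^sup>-\<^sup>s|F)\<close> that the \<open>A\<^sub>p\<close> condition supplies, rather
  than \<open>E(\<omega>\<^sup>-\<^sup>s|F)\<close> itself: \<open>c\<close> is visibly finite and positive, and it makes the final constant
  exactly \<open>C\<close>.
\<close>

lemma (in sigma_finite_subalgebra) exp_bound_if_A_p_bound:
  assumes w: "weight M \<omega>" and p: "p > 1" and C: "C > 0"
    and Ap: "AE x in M. ennreal (real_cond_exp M F \<omega> x) *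
        ennpowr (nn_cond_exp M F (\<lambda>y. ennreal (\<omega> y powr (- (1 / (p - 1))))) x) (p - 1)
        \<le> ennreal C"
  shows "AE x in M. ennreal (real_cond_exp M F \<omega> x)
        \<le> ennreal C * ereal_exp (ereal_cond_exp M F (\<lambda>y. ln (\<omega> y)) x)"
proof -
  have int: "integrable M \<omega>" and pos: "AE x in M. \<omega> x > 0"
    using w by (auto simp: weight_def)
  have [measurable]: "\<omega> \<in> borel_measurable M" using int by simp
  let ?W = "real_cond_exp M F \<omega>"
  define s where "s = 1 / (p - 1)"
  have s: "s > 0" using p by (simp add: s_def)
  define c where "c = (\<lambda>x. (C / ?W x) powr s)"
  have c_meas [measurable]: "c \<in> borel_measurable F" by (auto simp: c_def)
  let ?phi = "\<lambda>y. \<omega> y powr (- s)"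
  let ?b = "\<lambda>x. (ln (c x) - 1) / s" and ?k = "\<lambda>x. 1 / (s * c x)"
  have W: "AE x in M. ?W x > 0"
    by (rule real_cond_exp_gr_c[OF int pos])
  have "AE x in M. ereal_cond_exp M F (\<lambda>y. - ln (\<omega> y)) x
       \<le> ereal (?b x) + enn2ereal (nn_cond_exp M F (\<lambda>y. ennreal (?k y * ?phi y)) x)"
  proof (rule ereal_cond_exp_le)
    have "?k \<in> borel_measurable M" 
      by (rule measurable_from_subalg[OF subalg]) simp
    then show "(\<lambda>y. ?k y * ?phi y) \<in> borel_measurable M" by measurable
    show "AE x in M. 0 \<le> ?k x * ?phi x"
      using s by (simp add: c_def)
    show "AE x in M. - ln (\<omega> x) \<le> ?b x + ?k x * ?phi x"
      using pos W
    proof eventually_elim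
      case (elim x)
      then have cpos: "c x > 0" and phipos: "?phi x > 0" using C by (auto simp: c_def)
      have "- s * ln (\<omega> x) - ln (c x) = ln (?phi x / c x)"
        using elim cpos phipos by (simp add: ln_div ln_powr)
      also have "\<dots> \<le> ?phi x / c x - 1"
        using cpos phipos by (intro ln_le_minus_one) simp
      finally have "- ln (\<omega> x) * s \<le> ln (c x) - 1 + ?phi x / c x"
        by (simp add: mult.commute)
      then have "- ln (\<omega> x) \<le> (ln (c x) - 1 + ?phi x / c x) / s"
        using s by (simp add: pos_le_divide_eq)
      also have "\<dots> = ?b x + ?k x * ?phi x"
        by (simp add: add_divide_distrib mult.commute)
      finally show ?case .
    qed
  qed measurable
  moreover have "AE x in M. nn_cond_exp M F (\<lambda>y. ennreal (?k y * ?phi y)) x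
                   = ennreal (?k x) * nn_cond_exp M F (\<lambda>y. ennreal (?phi y)) x"
    using s by (intro nn_cond_exp_mult_left) (auto simp: c_def)
  ultimately show ?thesis
    using Ap[folded s_def] W
  proof eventually_elim
    case (elim x)
    let ?Phi = "nn_cond_exp M F (\<lambda>y. ennreal (?phi y)) x"
    let ?E = "ereal_cond_exp M F (\<lambda>y. - ln (\<omega> y)) x"
    have cpos: "c x > 0" using C elim(4) by (simp add: c_def)
    have Ap: "ennreal (?W x) * ennpowr ?Phi (p - 1) \<le> ennreal C"
      using elim(3) .
    have "?Phi \<noteq> \<infinity>"
    proof
      assume "?Phi = \<infinity>"
      then show False
        using Ap \<open>?W x > 0\<close> by (auto simp: ennpowr_def ennreal_mult_top top_unique)
    qed
    then obtain y where y: "?Phi = ennreal y" "y \<ge> 0"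
      by (metis ennreal_cases infinity_ennreal_def)
    have "ennreal (?W x * y powr (p - 1)) \<le> ennreal C"
      using Ap y \<open>?W x > 0\<close> by (simp add: ennpowr_def ennreal_mult')
    then have "y powr (p - 1) \<le> C / ?W x"
      using C \<open>?W x > 0\<close> by (simp add: field_simps)
    then have "(y powr (p - 1)) powr s \<le> c x"
      unfolding c_def using s by (intro powr_mono2) auto
    then have "y \<le> c x"
      using y p by (simp add: powr_powr s_def)
    then have "?k x * y \<le> 1 / s"
      using s cpos by (simp add: field_simps)
    moreover have "?k x \<ge> 0" using s cpos by simp
    ultimately have "?E \<le> ereal (?b x + 1 / s)"
      using elim(1,2) y by (simp add: ennreal_mult'[symmetric] order_trans)
    also have "?b x + 1 / s = ln (C / ?W x)"
      using s C \<open>?W x > 0\<close> by (simp add: c_def ln_powr field_simps)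
    finally have E: "?E \<le> ereal (ln C - ln (?W x))"
      using C \<open>?W x > 0\<close> by (simp add: ln_div)
    \<comment> \<open>The bound on \<open>E(- ln \<omega>|F)\<close> makes \<open>E((ln \<omega>)\<^sup>-|F)\<close> finite, so that changing the sign of
      the difference of the two parts is harmless.\<close>
    have "ereal (ln (?W x) - ln C) \<le> ereal_cond_exp M F (\<lambda>y. ln (\<omega> y)) x"
      using E unfolding ereal_cond_exp_def
      by (cases "nn_cond_exp M F (\<lambda>y. ennreal (- ln (\<omega> y))) x";
          cases "nn_cond_exp M F (\<lambda>y. ennreal (ln (\<omega> y))) x") auto
    then have "ennreal (exp (ln (?W x) - ln C)) \<le> ereal_exp (ereal_cond_exp M F (\<lambda>y. ln (\<omega> y)) x)"
      using ereal_exp_mono by (fastforce simp: ereal_exp_def)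
    then have "ennreal C * ennreal (?W x / C) \<le> ennreal C * ereal_exp (ereal_cond_exp M F (\<lambda>y. ln (\<omega> y)) x)"
      using C \<open>?W x > 0\<close> by (intro mult_left_mono) (auto simp: exp_diff)
    then show ?case
      using C by (simp add: ennreal_mult'[symmetric])
  qed
qed

section \<open>From the exponential to the median condition\<close>

text \<open>
  On the \<open>F\<close>-measurable set \<open>{m \<le> 0}\<close> we have \<open>\<omega> > m\<close> almost everywhere, so there
  \<open>E(\<chi>\<^bsub>{\<omega> > m}\<^esub>|F) = 1\<close>, which exceeds the bound \<open>1/2\<close> unless the set is null.
\<close>

lemma (in finite_measure_subalgebra) median_function_pos:
  assumes pos: "AE x in M. \<omega> x > 0" and [measurable]: "\<omega> \<in> borel_measurable M"
    and m: "median_function M F \<omega> m"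
  shows "AE x in M. m x > 0"
proof -
  have mF [measurable]: "m \<in> borel_measurable F" using m by (simp add: median_function_def)
  have [measurable]: "m \<in> borel_measurable M" using measurable_from_subalg[OF subalg mF] .
  let ?G = "{x \<in> space F. m x \<le> 0}" and ?U = "{y \<in> space M. \<omega> y > m y}"
  have sp: "space F = space M" using subalg by (simp add: subalgebra_def)
  have GF [measurable]: "?G \<in> sets F" by measurable
  have [measurable]: "?G \<in> sets M" using GF subalg by (auto simp: subalgebra_def)
  have "AE x in M. indicat_real ?G x * indicat_real ?U x = indicat_real ?G x"
    using pos by eventually_elim (auto simp: indicator_def sp)
  then have "AE x in M. real_cond_exp M F (\<lambda>x. indicat_real ?G x * indicat_real ?U x) x
      = real_cond_exp M F (indicat_real ?G) x"
    by (intro real_cond_exp_cong) auto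
  moreover have "AE x in M. real_cond_exp M F (\<lambda>x. indicat_real ?G x * indicat_real ?U x) x
      = indicat_real ?G x * real_cond_exp M F (indicat_real ?U) x"
  proof (rule real_cond_exp_mult)
    show "integrable M (\<lambda>x. indicat_real ?G x * indicat_real ?U x)"
    proof (rule integrable_const_bound[where B = 1])
      show "AE x in M. norm (indicat_real ?G x * indicat_real ?U x) \<le> 1"
        by (auto simp: indicator_def)
    qed measurable
  qed auto
  moreover have "AE x in M. real_cond_exp M F (indicat_real ?G) x = indicat_real ?G x"
    by (intro real_cond_exp_F_meas) (auto simp: less_top[symmetric])
  moreover have "AE x in M. real_cond_exp M F (indicat_real ?U) x \<le> 1 / 2"
    using m by (simp add: median_function_def)
  ultimately show ?thesis
    using AE_space
    by eventually_elim (auto simp: indicator_def sp split: if_splits)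
qed

text \<open>
  The tangent inequality at \<open>\<omega>/(m a)\<close> reads \<open>ln \<omega> \<le> ln m + (ln a - 1) + \<omega>/(m a)\<close>.  It is used on
  \<open>{\<omega> > m}\<close> only; elsewhere \<open>ln \<omega> \<le> ln m\<close> is better.  Hence the term \<open>ln a - 1\<close> gets the factor
  \<open>E(\<chi>\<^bsub>{\<omega> > m}\<^esub>|F) \<le> 1/2\<close>, and halving the logarithm is what closes the argument.
\<close>

lemma (in finite_measure_subalgebra) median_bound_if_exp_bound:
  assumes w: "weight M \<omega>" and C: "C > 0" and m: "median_function M F \<omega> m"
    and bound: "AE x in M. ennreal (real_cond_exp M F \<omega> x)
        \<le> ennreal C * ereal_exp (ereal_cond_exp M F (\<lambda>y. ln (\<omega> y)) x)"
  shows "AE x in M. real_cond_exp M F \<omega> x \<le> (2 * C\<^sup>2 + 2 * C) * m x"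
proof -
  have int: "integrable M \<omega>" and pos: "AE x in M. \<omega> x > 0"
    using w by (auto simp: weight_def)
  have [measurable]: "\<omega> \<in> borel_measurable M" using int by simp
  have mF [measurable]: "m \<in> borel_measurable F" using m by (simp add: median_function_def)
  have mM [measurable]: "m \<in> borel_measurable M" using measurable_from_subalg[OF subalg mF] .
  have mpos: "AE x in M. m x > 0" using median_function_pos[OF pos _ m] by simp
  let ?W = "real_cond_exp M F \<omega>"
  let ?U = "{y \<in> space M. \<omega> y > m y}"
  have W: "AE x in M. ?W x > 0"
    by (rule real_cond_exp_gr_c[OF int pos])
  \<comment> \<open>The value \<open>2 W/m\<close> makes \<open>W/(m a)\<close> at most \<open>1/2\<close>, which offsets the \<open>- 1/2\<close> in
    \<open>(ln a - 1)/2\<close>.  The lower bound \<open>e\<close> keeps \<open>ln a - 1\<close> nonnegative, so that an upper bound on its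
    factor may be used.\<close>
  define a where "a = (\<lambda>x. max (2 * ?W x / m x) (exp 1))"
  have aF [measurable]: "a \<in> borel_measurable F" by (simp add: a_def)
  have [measurable]: "a \<in> borel_measurable M" by (simp add: a_def)
  have apos: "a x > 0" and lna: "ln (a x) - 1 \<ge> 0" for x
  proof -
    show "a x > 0" unfolding a_def by (simp add: less_max_iff_disj)
    then have "ln (exp 1) \<le> ln (a x)" by (subst ln_le_cancel_iff) (auto simp: a_def)
    then show "ln (a x) - 1 \<ge> 0" by simp
  qed
  let ?l = "\<lambda>x. ln (a x) - 1" and ?k = "\<lambda>x. 1 / (m x * a x)"
  let ?h = "\<lambda>x. ?l x * indicat_real ?U x + ?k x * \<omega> x"
  let ?E = "nn_cond_exp M F"
  have kpos: "AE x in M. ?k x \<ge> 0"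
    using mpos by eventually_elim (use apos in \<open>simp add: less_imp_le\<close>)
  have "AE x in M. ereal_cond_exp M F (\<lambda>y. ln (\<omega> y)) x
       \<le> ereal (ln (m x)) + enn2ereal (?E (\<lambda>y. ennreal (?h y)) x)"
  proof (rule ereal_cond_exp_le)
    show "AE x in M. 0 \<le> ?h x"
      using kpos pos by eventually_elim (use lna in simp)
    show "AE x in M. ln (\<omega> x) \<le> ln (m x) + ?h x"
      using mpos pos AE_space
    proof eventually_elim
      case (elim x)
      show ?case
      proof (cases "\<omega> x > m x")
        case True
        have "ln (\<omega> x / (m x * a x)) \<le> \<omega> x / (m x * a x) - 1"
          using elim apos[of x] by (intro ln_le_minus_one) simp
        then show ?thesis
          using elim apos[of x] True by (simp add: ln_div ln_mult)
      next
        case False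
        then have "ln (\<omega> x) \<le> ln (m x)" using elim by simp
        then show ?thesis
          using elim apos[of x] False by (simp add: add_increasing2)
      qed
    qed
  qed measurable
  moreover have "AE x in M. ?E (\<lambda>y. ennreal (?h y)) x
      = ?E (\<lambda>y. ennreal (?l y * indicat_real ?U y) + ennreal (?k y * \<omega> y)) x"
  proof (rule nn_cond_exp_cong)
    show "AE x in M. ennreal (?h x) = ennreal (?l x * indicat_real ?U x) + ennreal (?k x * \<omega> x)"
      using kpos pos by eventually_elim (use lna in \<open>simp add: ennreal_plus[symmetric] del: ennreal_plus\<close>)
  qed measurable
  moreover have "AE x in M. ?E (\<lambda>y. ennreal (?l y * indicat_real ?U y)) x + ?E (\<lambda>y. ennreal (?k y * \<omega> y)) x
      = ?E (\<lambda>y. ennreal (?l y * indicat_real ?U y) + ennreal (?k y * \<omega> y)) x"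
    by (intro nn_cond_exp_sum) auto
  moreover have "AE x in M. ?E (\<lambda>y. ennreal (?l y * indicat_real ?U y)) x
      = ennreal (?l x) * ?E (\<lambda>y. ennreal (indicat_real ?U y)) x"
    using lna by (intro nn_cond_exp_mult_left) auto
  moreover have "AE x in M. ?E (\<lambda>y. ennreal (?k y * \<omega> y)) x
      = ennreal (?k x) * ?E (\<lambda>y. ennreal (\<omega> y)) x"
    using kpos by (intro nn_cond_exp_mult_left) auto
  moreover have "AE x in M. ?E (\<lambda>y. ennreal (indicat_real ?U y)) x
      = ennreal (real_cond_exp M F (indicat_real ?U) x)"
    by (intro nn_cond_exp_integrable) (auto simp: less_top[symmetric])
  moreover have "AE x in M. ?E (\<lambda>y. ennreal (\<omega> y)) x = ennreal (?W x)"
    using pos by (intro nn_cond_exp_integrable int) auto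
  moreover have "AE x in M. real_cond_exp M F (indicat_real ?U) x \<le> 1 / 2"
    using m by (simp add: median_function_def)
  moreover have "AE x in M. real_cond_exp M F (indicat_real ?U) x \<ge> 0"
    by (intro real_cond_exp_pos) auto
  ultimately show ?thesis
    using mpos W kpos bound
  proof eventually_elim
    case (elim x)
    let ?P = "real_cond_exp M F (indicat_real ?U) x" and ?L = "ereal_cond_exp M F (\<lambda>y. ln (\<omega> y)) x"
    have "?E (\<lambda>y. ennreal (?h y)) x = ennreal (?l x) * ennreal ?P + ennreal (?k x) * ennreal (?W x)"
      by (simp only: elim(2) elim(3)[symmetric] elim(4-7))
    also have "\<dots> = ennreal (?l x * ?P + ?k x * ?W x)"
    proof -
      have "ennreal u * ennreal v + ennreal y * ennreal z = ennreal (u * v + y * z)"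
        if "0 \<le> u" "0 \<le> v" "0 \<le> y" "0 \<le> z" for u v y z
        using that by (simp add: ennreal_mult)
      then show ?thesis using elim(9,11,12) lna[of x] by (simp del: ennreal_plus)
    qed
    finally have "?E (\<lambda>y. ennreal (?h y)) x = ennreal (?l x * ?P + ?k x * ?W x)" .
    moreover have "?l x * ?P + ?k x * ?W x \<ge> 0"
      using elim lna[of x] by simp
    ultimately have L: "?L \<le> ereal (ln (m x) + (?l x * ?P + ?k x * ?W x))"
      using elim(1) by simp
    have "?l x * ?P \<le> ?l x * (1 / 2)"
      using elim lna[of x] by (intro mult_left_mono) auto
    moreover have "?k x * ?W x \<le> 1 / 2"
    proof -
      have "2 * ?W x / m x \<le> a x" by (simp add: a_def)
      then show ?thesis using elim apos[of x] by (simp add: field_simps)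
    qed
    ultimately have "ln (m x) + (?l x * ?P + ?k x * ?W x) \<le> ln (m x) + ln (a x) / 2"
      by (simp add: field_simps)
    with L have "?L \<le> ereal (ln (m x) + ln (a x) / 2)"
      by (meson ereal_less_eq(3) order_trans)
    also have "ln (m x) + ln (a x) / 2 = ln (m x * sqrt (a x))"
      using elim apos[of x] by (simp add: ln_mult ln_sqrt)
    finally have "ereal_exp ?L \<le> ennreal (m x * sqrt (a x))"
      using ereal_exp_mono[of ?L "ereal (ln (m x * sqrt (a x)))"] elim apos[of x]
      by (simp add: ereal_exp_def)
    then have "ennreal (?W x) \<le> ennreal C * ennreal (m x * sqrt (a x))"
      using elim by (meson mult_left_mono order_trans zero_le)
    then have "?W x \<le> C * (m x * sqrt (a x))"
      using C elim apos[of x] by (simp add: ennreal_mult'[symmetric] less_imp_le)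
    define R where "R = ?W x / m x"
    have R: "R > 0" "R \<le> C * sqrt (a x)"
      using elim \<open>?W x \<le> _\<close> by (auto simp: R_def field_simps)
    \<comment> \<open>Solving \<open>R \<le> C sqrt (max (2 R) e)\<close>: the two branches give \<open>2 C\<^sup>2\<close> and \<open>2 C\<close>.\<close>
    have "R \<le> 2 * C\<^sup>2 + 2 * C"
    proof (cases "2 * R \<le> exp 1")
      case True
      then have "a x = exp 1" by (simp add: a_def R_def max_def)
      moreover have "exp 1 \<le> (4::real)" using exp_le by linarith
      ultimately have "sqrt (a x) \<le> 2" by (intro real_le_lsqrt) auto
      then have "C * sqrt (a x) \<le> C * 2" using C by (intro mult_left_mono) auto
      then show ?thesis using R by (simp add: add_increasing)
    next
      case False
      then have "a x = 2 * R" by (simp add: a_def R_def max_def)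
      then have "R\<^sup>2 \<le> (C * sqrt (2 * R))\<^sup>2" using R by (intro power_mono) auto
      then have "R * R \<le> (2 * C\<^sup>2) * R" using R by (simp add: power_mult_distrib power2_eq_square mult_ac)
      then show ?thesis using R C by (simp add: add_increasing2)
    qed
    then show ?case using elim by (simp add: R_def field_simps)
  qed
qed

section \<open>From the median to Muckenhoupt's condition\<close>

text \<open>
  The weight dominates \<open>m\<close> on \<open>B = {\<omega> \<ge> m} - A\<close>, so
  \<open>E(\<chi>\<^sub>A \<omega>|F) + m E(\<chi>\<^sub>B|F) \<le> E(\<omega>|F)\<close>.  As \<open>A\<close>, \<open>B\<close> and \<open>{\<omega> < m}\<close> cover the space,
  \<open>E(\<chi>\<^sub>B|F) \<ge> 1 - 1/4 - 1/2\<close>.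
\<close>

lemma (in finite_measure_subalgebra) weighted_cond_exp_le_if_median_bound:
  assumes w: "weight M \<omega>" and C: "C > 0" and m: "median_function M F \<omega> m"
    and bound: "AE x in M. real_cond_exp M F \<omega> x \<le> C * m x"
    and A [measurable]: "A \<in> sets M"
    and small: "AE x in M. real_cond_exp M F (indicat_real A) x \<le> 1 / 4"
  shows "AE x in M. weighted_cond_exp M F \<omega> (indicat_real A) x \<le> 1 - 1 / (4 * C)"
proof -
  have int: "integrable M \<omega>" and pos: "AE x in M. \<omega> x > 0"
    using w by (auto simp: weight_def)
  have [measurable]: "\<omega> \<in> borel_measurable M" using int by simp
  have mF [measurable]: "m \<in> borel_measurable F" using m by (simp add: median_function_def)
  have mM [measurable]: "m \<in> borel_measurable M" using measurable_from_subalg[OF subalg mF] .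
  have mpos: "AE x in M. m x > 0" using median_function_pos[OF pos _ m] by simp
  let ?W = "real_cond_exp M F \<omega>"
  let ?V = "{y \<in> space M. \<omega> y < m y}"
  define B where "B = {y \<in> space M. m y \<le> \<omega> y} - A"
  have [measurable]: "B \<in> sets M" by (simp add: B_def)
  have ind: "integrable M (indicat_real S)" if "S \<in> sets M" for S
    using that by (auto simp: less_top[symmetric])
  have intA: "integrable M (\<lambda>x. indicat_real A x * \<omega> x)"
    by (rule Bochner_Integration.integrable_bound[OF int]) (auto simp: indicator_def)
  \<comment> \<open>On \<open>B\<close> the weight itself is an integrable bound: \<open>0 \<le> m \<le> \<omega>\<close>.\<close>
  have intB: "integrable M (\<lambda>x. m x * indicat_real B x)"
  proof (rule Bochner_Integration.integrable_bound[OF int])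
    show "AE x in M. norm (m x * indicat_real B x) \<le> norm (\<omega> x)"
      using mpos pos by eventually_elim (auto simp: indicator_def B_def)
  qed measurable
  have "AE x in M. real_cond_exp M F (\<lambda>x. indicat_real A x * \<omega> x + m x * indicat_real B x) x \<le> ?W x"
  proof (rule real_cond_exp_mono)
    show "AE x in M. indicat_real A x * \<omega> x + m x * indicat_real B x \<le> \<omega> x"
      using pos by eventually_elim (auto simp: indicator_def B_def)
  qed (use intA intB int in auto)
  moreover have "AE x in M. real_cond_exp M F (\<lambda>x. indicat_real A x * \<omega> x + m x * indicat_real B x) x
     = real_cond_exp M F (\<lambda>x. indicat_real A x * \<omega> x) x + real_cond_exp M F (\<lambda>x. m x * indicat_real B x) x"
    by (rule real_cond_exp_add[OF intA intB])
  moreover have "AE x in M. real_cond_exp M F (\<lambda>x. m x * indicat_real B x) x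
     = m x * real_cond_exp M F (indicat_real B) x"
    by (rule real_cond_exp_mult[OF mF _ intB]) simp
  moreover have "AE x in M. 1 \<le> real_cond_exp M F (\<lambda>x. (indicat_real B x + indicat_real A x) + indicat_real ?V x) x"
  proof (rule real_cond_exp_ge_c)
    show "AE x in M. 1 \<le> (indicat_real B x + indicat_real A x) + indicat_real ?V x"
      using AE_space by eventually_elim (auto simp: indicator_def B_def)
  qed (auto intro!: ind Bochner_Integration.integrable_add)
  moreover have "AE x in M. real_cond_exp M F (\<lambda>x. (indicat_real B x + indicat_real A x) + indicat_real ?V x) x
     = real_cond_exp M F (\<lambda>x. indicat_real B x + indicat_real A x) x + real_cond_exp M F (indicat_real ?V) x"
    by (intro real_cond_exp_add Bochner_Integration.integrable_add ind) auto
  moreover have "AE x in M. real_cond_exp M F (\<lambda>x. indicat_real B x + indicat_real A x) x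
     = real_cond_exp M F (indicat_real B) x + real_cond_exp M F (indicat_real A) x"
    by (intro real_cond_exp_add ind) auto
  moreover have "AE x in M. real_cond_exp M F (indicat_real ?V) x \<le> 1 / 2"
    using m by (simp add: median_function_def)
  moreover have "AE x in M. ?W x > 0"
    by (rule real_cond_exp_gr_c[OF int pos])
  ultimately show ?thesis
    using small mpos bound
  proof eventually_elim
    case (elim x)
    have "real_cond_exp M F (indicat_real B) x \<ge> 1 / 4" using elim by linarith
    then have "m x * real_cond_exp M F (indicat_real B) x \<ge> m x * (1 / 4)"
      using elim by (intro mult_left_mono) auto
    moreover have "?W x / (4 * C) \<le> m x * (1 / 4)"
      using elim C by (simp add: field_simps)
    moreover have "real_cond_exp M F (\<lambda>x. indicat_real A x * \<omega> x) x
        + m x * real_cond_exp M F (indicat_real B) x \<le> ?W x"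
      using elim(1-3) by simp
    ultimately have "real_cond_exp M F (\<lambda>x. indicat_real A x * \<omega> x) x \<le> ?W x - ?W x / (4 * C)"
      by linarith
    also have "\<dots> = ?W x * (1 - 1 / (4 * C))"
      by (simp add: right_diff_distrib)
    finally show ?case
      using elim(8) by (simp add: weighted_cond_exp_def divide_le_eq mult.commute)
  qed
qed

section \<open>The chain of implications\<close>

theorem theorem1p7:
  fixes M :: "'a measure" and F :: "nat \<Rightarrow> 'a measure"
    and \<omega> :: "'a \<Rightarrow> real" and m :: "nat \<Rightarrow> 'a \<Rightarrow> real"
  assumes "prob_space M" and "complete_measure M"
    and "\<And>n. subalgebra M (F n)" and "filtration (space M) F"
    and "sets M = sigma_sets (space M) (\<Union>n. sets (F n))"
    and "weight M \<omega>"
    and "\<And>n. median_function M (F n) \<omega> (m n)"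
  shows "((\<exists>p>1. A_p M F p \<omega>) \<longrightarrow> A_inf_exp M F \<omega>) \<and>
         (A_inf_exp M F \<omega> \<longrightarrow> A_inf_med M F m \<omega>) \<and>
         (A_inf_med M F m \<omega> \<longrightarrow> A_inf_M M F \<omega>)"
proof (intro conjI impI)
  interpret prob_space M by fact
  have fin: "finite_measure_subalgebra M (F n)" for n
    using assms(3) by (intro finite_measure_subalgebra.intro finite_measure_subalgebra_axioms.intro)
      (auto intro: finite_measure_axioms)
  have sig: "sigma_finite_subalgebra M (F n)" for n
    by (rule finite_measure_subalgebra_is_sigma_finite[OF fin])
  {
    assume "\<exists>p>1. A_p M F p \<omega>"
    then obtain p C where "p > 1" "C > 1" and Ap: "\<And>n. AE x in M.
        ennreal (real_cond_exp M (F n) \<omega> x) *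
        ennpowr (nn_cond_exp M (F n) (\<lambda>y. ennreal (\<omega> y powr (- (1 / (p - 1))))) x) (p - 1)
        \<le> ennreal C"
      by (auto simp: A_p_def)
    then show "A_inf_exp M F \<omega>"
      using sigma_finite_subalgebra.exp_bound_if_A_p_bound[OF sig assms(6) \<open>p > 1\<close> _ Ap]
      unfolding A_inf_exp_def by (intro exI[of _ C]) auto
  next
    assume "A_inf_exp M F \<omega>"
    then obtain C where C: "C > 0" and bound: "\<And>n. AE x in M. ennreal (real_cond_exp M (F n) \<omega> x)
        \<le> ennreal C * ereal_exp (ereal_cond_exp M (F n) (\<lambda>y. ln (\<omega> y)) x)"
      by (auto simp: A_inf_exp_def)
    \<comment> \<open>The summand \<open>1\<close> only serves to make the constant exceed \<open>1\<close>; it is affordable as \<open>m > 0\<close>.\<close>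
    let ?C = "2 * C\<^sup>2 + 2 * C + 1"
    have "AE x in M. real_cond_exp M (F n) \<omega> x \<le> ?C * m n x" for n
    proof -
      have "AE x in M. m n x > 0"
        using assms(6) by (intro finite_measure_subalgebra.median_function_pos[OF fin _ _ assms(7)]) (auto simp: weight_def)
      with finite_measure_subalgebra.median_bound_if_exp_bound[OF fin assms(6) C assms(7) bound[of n]]
      show ?thesis
        by eventually_elim (simp add: algebra_simps)
    qed
    moreover have "?C > 1" using C by (simp add: add_pos_pos)
    ultimately show "A_inf_med M F m \<omega>"
      unfolding A_inf_med_def by blast
  next
    assume "A_inf_med M F m \<omega>"
    then obtain C where C: "C > 1" and bound: "\<And>n. AE x in M. real_cond_exp M (F n) \<omega> x \<le> C * m n x"
      by (auto simp: A_inf_med_def)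
    have "AE x in M. weighted_cond_exp M (F n) \<omega> (indicat_real A) x \<le> 1 - 1 / (4 * C)"
      if "A \<in> sets M" "AE x in M. real_cond_exp M (F n) (indicat_real A) x \<le> 1 / 4" for n A
      using C that
      by (intro finite_measure_subalgebra.weighted_cond_exp_le_if_median_bound[OF fin assms(6) _ assms(7) bound])
        auto
    then show "A_inf_M M F \<omega>"
      unfolding A_inf_M_def using C
      by (intro exI[of _ "1 / 4"] exI[of _ "1 - 1 / (4 * C)"]) (auto simp: field_simps)
  }
qed

end
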